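(* Let $H$ be an abelian group with an alternating $\mathbb{Z}$-bilinear form $\langle -,-\rangle : H\times H\to\mathbb{Z}$, and let $\mathbb{Q}H$ be the homological Goldman Lie algebra of $(H,\langle -,-\rangle)$. For any ideal $\mathfrak{h}$ of $\mathbb{Q}H$, there exists a unique pair $(V_0,V)$ such that (1) $V_0$ and $V$ are $\mathbb{Q}$-subspaces of $\mathbb{Q}\bar{0}=\mathbb{Q}\ker\mu$; (2) $V$ has the $\ker\mu$-stability, i.e. $T(a)(V)\subset V$ for all $a\in\ker\mu$; and (3) $\mathfrak{h} = V_0\oplus\bigoplus_{\bar{x}\in\bar{H}\setminus\{\bar{0}\}} T(\bar{x})(V)$ (internal direct sum in $\mathbb{Q}H$), where $T(\bar{x})(V):=T(x)(V)$, which is independent of the choice of representative $x$ of $\bar{x}$ by (2). Here, if $\mu=0$, one uses the convention that $V$ is defined to be $0$. Conversely, for any pair $(V_0,V)$ satisfying (1) and (2), the set $\mathfrak{h}$ given by (3) is an ideal of $\mathbb{Q}H$.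
   Context: $H$ is an abelian group and $\langle -,-\rangle : H\times H\to\mathbb{Z}$ is an alternating $\mathbb{Z}$-bilinear form. The homomorphism $\mu:H\to\mathrm{Hom}_{\mathbb{Z}}(H,\mathbb{Z})$ is defined by $\mu(x)(y)=\langle x,y\rangle$. $\mathbb{Q}H$ is the $\mathbb{Q}$-vector space with basis the set $H$; the basis element corresponding to $x\in H$ is written $[x]$. The homological Goldman Lie algebra of $(H,\langle -,-\rangle)$ is $\mathbb{Q}H$ with the $\mathbb{Q}$-bilinear Lie bracket determined by $[[x],[y]]=\langle x,y\rangle[x+y]$ for $x,y\in H$. An ideal is a $\mathbb{Q}$-subspace $\mathfrak{h}$ with $[\mathfrak{h},\mathbb{Q}H]\subset\mathfrak{h}$. Write $\bar{H}=H/\ker\mu$ and $\bar{x}=x+\ker\mu$ for $x\in H$. For a subset $S\subset H$ (such as a coset $\bar{x}$), $\mathbb{Q}S\subset\mathbb{Q}H$ is the $\mathbb{Q}$-span of $\{[s]: s\in S\}$. For $x\in H$, $T(x):\mathbb{Q}H\to\mathbb{Q}H$ is the $\mathbb{Q}$-linear map with $T(x)([y])=[x+y]$ for $y\in H$. *)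

theory Defs
  imports Complex_Main "HOL-Library.Poly_Mapping"
begin

text \<open>
  \<open>\<rat>H\<close> is the type of finitely supported functions from \<open>H\<close> to \<open>\<rat>\<close>. Its pointwise
  scalar multiplication makes it a rational vector space, whose subspaces and spans are
  \<open>QH.subspace\<close> and \<open>QH.span\<close>.
\<close>

definition qscale :: "rat \<Rightarrow> ('a \<Rightarrow>\<^sub>0 rat) \<Rightarrow> ('a \<Rightarrow>\<^sub>0 rat)" where
  "qscale c u = Poly_Mapping.map (\<lambda>a. c * a) u"

lemma lookup_qscale [simp]: "Poly_Mapping.lookup (qscale c u) x = c * Poly_Mapping.lookup u x"
  by (simp add: qscale_def Poly_Mapping.map.rep_eq when_def)

interpretation QH: vector_space qscale
  by unfold_locales (auto intro!: poly_mapping_eqI simp: lookup_add algebra_simps)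

abbreviation basis_elt :: "'a \<Rightarrow> ('a \<Rightarrow>\<^sub>0 rat)" where
  "basis_elt x \<equiv> Poly_Mapping.single x 1"

definition span_of :: "'a set \<Rightarrow> ('a \<Rightarrow>\<^sub>0 rat) set" where
  "span_of S = QH.span (basis_elt ` S)"

text \<open>The linear map that sends each basis element \<open>[x]\<close> to \<open>g x\<close>.\<close>

definition lin_ext :: "('a \<Rightarrow> ('b \<Rightarrow>\<^sub>0 rat)) \<Rightarrow> ('a \<Rightarrow>\<^sub>0 rat) \<Rightarrow> ('b \<Rightarrow>\<^sub>0 rat)" where
  "lin_ext g u = (\<Sum>x\<in>Poly_Mapping.keys u. qscale (Poly_Mapping.lookup u x) (g x))"

lemma lin_ext_superset:
  assumes "finite A" "Poly_Mapping.keys u \<subseteq> A"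
  shows "lin_ext g u = (\<Sum>x\<in>A. qscale (Poly_Mapping.lookup u x) (g x))"
  unfolding lin_ext_def
  by (rule sum.mono_neutral_left) (use assms in \<open>auto simp: in_keys_iff\<close>)

lemma lin_ext_basis_elt [simp]: "lin_ext g (basis_elt x) = g x"
  by (simp add: lin_ext_def)

lemma lin_ext_add: "lin_ext g (u + v) = lin_ext g u + lin_ext g v"
proof -
  let ?A = "Poly_Mapping.keys u \<union> Poly_Mapping.keys v"
  have "Poly_Mapping.keys (u + v) \<subseteq> ?A" by (rule Poly_Mapping.keys_add)
  then show ?thesis
    by (simp add: lin_ext_superset[of ?A] lookup_add QH.scale_left_distrib sum.distrib)
qed

lemma lin_ext_qscale: "lin_ext g (qscale c u) = qscale c (lin_ext g u)"
proof -
  have "Poly_Mapping.keys (qscale c u) \<subseteq> Poly_Mapping.keys u" by (auto simp: in_keys_iff)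
  then show ?thesis
    by (simp add: lin_ext_superset[of "Poly_Mapping.keys u"] QH.scale_sum_right)
qed

definition alternating_bilinear :: "('h::ab_group_add \<Rightarrow> 'h \<Rightarrow> int) \<Rightarrow> bool" where
  "alternating_bilinear \<omega> \<longleftrightarrow>
     (\<forall>x y z. \<omega> (x + y) z = \<omega> x z + \<omega> y z) \<and>
     (\<forall>x y z. \<omega> x (y + z) = \<omega> x y + \<omega> x z) \<and>
     (\<forall>x. \<omega> x x = 0)"

definition mu :: "('h::ab_group_add \<Rightarrow> 'h \<Rightarrow> int) \<Rightarrow> 'h \<Rightarrow> ('h \<Rightarrow> int)" where
  "mu \<omega> x = (\<lambda>y. \<omega> x y)"

definition ker_mu :: "('h::ab_group_add \<Rightarrow> 'h \<Rightarrow> int) \<Rightarrow> 'h set" where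
  "ker_mu \<omega> = {x. mu \<omega> x = (\<lambda>_. 0)}"

definition goldman_bracket ::
  "('h::ab_group_add \<Rightarrow> 'h \<Rightarrow> int) \<Rightarrow> ('h \<Rightarrow>\<^sub>0 rat) \<Rightarrow> ('h \<Rightarrow>\<^sub>0 rat) \<Rightarrow> ('h \<Rightarrow>\<^sub>0 rat)" where
  "goldman_bracket \<omega> u v =
     lin_ext (\<lambda>x. lin_ext (\<lambda>y. qscale (of_int (\<omega> x y)) (basis_elt (x + y))) v) u"

lemma goldman_bracket_basis_elt:
  "goldman_bracket \<omega> (basis_elt x) (basis_elt y) = qscale (of_int (\<omega> x y)) (basis_elt (x + y))"
  by (simp add: goldman_bracket_def)

lemma goldman_bracket_bilinear:
  "goldman_bracket \<omega> (u + u') v = goldman_bracket \<omega> u v + goldman_bracket \<omega> u' v"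
  "goldman_bracket \<omega> u (v + v') = goldman_bracket \<omega> u v + goldman_bracket \<omega> u v'"
  "goldman_bracket \<omega> (qscale c u) v = qscale c (goldman_bracket \<omega> u v)"
  "goldman_bracket \<omega> u (qscale c v) = qscale c (goldman_bracket \<omega> u v)"
proof -
  show "goldman_bracket \<omega> (u + u') v = goldman_bracket \<omega> u v + goldman_bracket \<omega> u' v"
    "goldman_bracket \<omega> (qscale c u) v = qscale c (goldman_bracket \<omega> u v)"
    by (simp_all add: goldman_bracket_def lin_ext_add lin_ext_qscale)
  show "goldman_bracket \<omega> u (v + v') = goldman_bracket \<omega> u v + goldman_bracket \<omega> u v'"
    unfolding goldman_bracket_def lin_ext_add
    by (simp add: lin_ext_def[of _ u] QH.scale_right_distrib sum.distrib)
  show "goldman_bracket \<omega> u (qscale c v) = qscale c (goldman_bracket \<omega> u v)"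
    unfolding goldman_bracket_def lin_ext_qscale
    by (simp add: lin_ext_def[of _ u] QH.scale_sum_right mult.commute)
qed

definition goldman_ideal :: "('h::ab_group_add \<Rightarrow> 'h \<Rightarrow> int) \<Rightarrow> ('h \<Rightarrow>\<^sub>0 rat) set \<Rightarrow> bool" where
  "goldman_ideal \<omega> I \<longleftrightarrow>
     QH.subspace I \<and> (\<forall>u\<in>I. \<forall>v. goldman_bracket \<omega> u v \<in> I)"

definition bar :: "('h::ab_group_add \<Rightarrow> 'h \<Rightarrow> int) \<Rightarrow> 'h \<Rightarrow> 'h set" where
  "bar \<omega> x = (+) x ` ker_mu \<omega>"

definition H_bar :: "('h::ab_group_add \<Rightarrow> 'h \<Rightarrow> int) \<Rightarrow> 'h set set" where
  "H_bar \<omega> = bar \<omega> ` UNIV"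

definition translate :: "'h::ab_group_add \<Rightarrow> ('h \<Rightarrow>\<^sub>0 rat) \<Rightarrow> ('h \<Rightarrow>\<^sub>0 rat)" where
  "translate x = lin_ext (\<lambda>y. basis_elt (x + y))"

definition ker_stable :: "('h::ab_group_add \<Rightarrow> 'h \<Rightarrow> int) \<Rightarrow> ('h \<Rightarrow>\<^sub>0 rat) set \<Rightarrow> bool" where
  "ker_stable \<omega> V \<longleftrightarrow> (\<forall>a\<in>ker_mu \<omega>. translate a ` V \<subseteq> V)"

text \<open>
  \<open>T(C)(V)\<close> for a coset \<open>C\<close>, by means of a chosen representative; the lemma
  \<open>translate_coset_bar\<close> below shows that for stable \<open>V\<close> every representative gives the
  same set.
\<close>

definition translate_coset :: "'h::ab_group_add set \<Rightarrow> ('h \<Rightarrow>\<^sub>0 rat) set \<Rightarrow> ('h \<Rightarrow>\<^sub>0 rat) set" where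
  "translate_coset C V = translate (SOME x. x \<in> C) ` V"

lemma bar_0: "bar \<omega> 0 = ker_mu \<omega>"
  by (simp add: bar_def)

lemma translate_translate: "translate x (translate y u) = translate (x + y) u"
proof -
  have "translate x (sum f A) = (\<Sum>a\<in>A. translate x (f a))"
    for f :: "'a \<Rightarrow> ('a \<Rightarrow>\<^sub>0 rat)" and A
    by (induction A rule: infinite_finite_induct)
       (simp_all add: translate_def lin_ext_add, simp_all add: lin_ext_def)
  then show ?thesis
    unfolding translate_def[of y] translate_def[of "x + y"]
    unfolding lin_ext_def[of _ u]
    by (simp add: translate_def lin_ext_qscale add.assoc)
qed

lemma translate_0 [simp]: "translate 0 u = u"
  by (rule poly_mapping_eqI)
     (auto simp: translate_def lin_ext_def lookup_sum lookup_single when_def in_keys_iff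
        if_distrib cong: if_cong)

lemma translate_coset_bar:
  assumes "alternating_bilinear \<omega>" "ker_stable \<omega> V"
  shows "translate_coset (bar \<omega> x) V = translate x ` V"
proof -
  have add: "\<omega> (y + z) w = \<omega> y w + \<omega> z w" for y z w
    using assms(1) by (simp add: alternating_bilinear_def)
  have zero: "\<omega> 0 w = 0" for w
    using add[of 0 0 w] by simp
  have minus: "- a \<in> ker_mu \<omega>" if "a \<in> ker_mu \<omega>" for a
  proof -
    have "\<omega> a w = 0" for w
      using that by (simp add: ker_mu_def mu_def fun_eq_iff)
    then have "\<omega> (- a) w = 0" for w
      using add[of a "- a" w] zero by simp
    then show ?thesis by (simp add: ker_mu_def mu_def fun_eq_iff)
  qed
  have "0 \<in> ker_mu \<omega>"
    using zero by (simp add: ker_mu_def mu_def fun_eq_iff)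
  then have "x \<in> bar \<omega> x" by (force simp: bar_def)
  then have "(SOME z. z \<in> bar \<omega> x) \<in> bar \<omega> x" by (rule someI)
  then obtain a where a: "a \<in> ker_mu \<omega>" "(SOME z. z \<in> bar \<omega> x) = x + a"
    by (auto simp: bar_def)
  have "translate a ` V = V"
  proof
    show "translate a ` V \<subseteq> V" using assms(2) a by (auto simp: ker_stable_def)
    have "translate (- a) ` V \<subseteq> V" using assms(2) minus a by (auto simp: ker_stable_def)
    moreover have "u = translate a (translate (- a) u)" for u
      by (simp add: translate_translate)
    ultimately show "V \<subseteq> translate a ` V" by blast
  qed
  moreover have "translate (x + a) ` V = translate x ` translate a ` V"
    by (simp add: image_image translate_translate)
  ultimately show ?thesis by (simp add: translate_coset_def a)
qed

definition internal_direct_sum ::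
  "'i set \<Rightarrow> ('i \<Rightarrow> ('a \<Rightarrow>\<^sub>0 rat) set) \<Rightarrow> ('a \<Rightarrow>\<^sub>0 rat) set \<Rightarrow> bool" where
  "internal_direct_sum I W U \<longleftrightarrow>
     (\<forall>i\<in>I. QH.subspace (W i)) \<and>
     U = QH.span (\<Union>i\<in>I. W i) \<and>
     (\<forall>i\<in>I. W i \<inter> QH.span (\<Union>j\<in>I - {i}. W j) = {0})"

text \<open>
  The summands of \<open>V\<^sub>0 \<oplus> \<Oplus> T(C)(V)\<close>, indexed by all cosets: the summand \<open>V\<^sub>0\<close> sits at the
  zero coset, so that \<open>C\<close> ranges over the nonzero ones in the remaining summands.
\<close>

definition goldman_summand ::
  "('h::ab_group_add \<Rightarrow> 'h \<Rightarrow> int) \<Rightarrow> ('h \<Rightarrow>\<^sub>0 rat) set \<Rightarrow> ('h \<Rightarrow>\<^sub>0 rat) set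
    \<Rightarrow> 'h set \<Rightarrow> ('h \<Rightarrow>\<^sub>0 rat) set" where
  "goldman_summand \<omega> V0 V C = (if C = bar \<omega> 0 then V0 else translate_coset C V)"

definition kernel_subspace :: "('h::ab_group_add \<Rightarrow> 'h \<Rightarrow> int) \<Rightarrow> ('h \<Rightarrow>\<^sub>0 rat) set \<Rightarrow> bool" where
  "kernel_subspace \<omega> V \<longleftrightarrow> QH.subspace V \<and> V \<subseteq> span_of (ker_mu \<omega>)"

end

theory Submission
  imports Defs "HOL-Library.Disjoint_Sets"
begin

text \<open>
  The operators \<open>ad [y]\<close>, which send \<open>[x]\<close> to \<open>\<langle>x, y\<rangle> [x + y]\<close>, do two things to an ideal.

  They separate the cosets of \<open>ker \<mu>\<close>. Bracketing with \<open>[y]\<close>, again with \<open>[y]\<close> and then with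
  \<open>[-2y]\<close> returns every basis element \<open>[x]\<close> to its own line, with the factor
  \<open>-2 \<langle>x, y\<rangle>\<^sup>3\<close>. The ideal is thus stable under the diagonal operators
  \<open>[x] \<mapsto> \<langle>x, y\<rangle>\<^sup>3 [x]\<close> (\<open>ideal_cube_operator\<close>). Two elements of \<open>H\<close> in different cosets
  differ in \<open>\<langle>-, y\<rangle>\<close> for some \<open>y\<close>, and cubing is injective, so these eigenvalues distinguish all
  cosets. Bracketing only with \<open>[y]\<close> and \<open>[-y]\<close> would give \<open>-\<langle>x, y\<rangle>\<^sup>2\<close> and could not tell
  \<open>x\<close> from \<open>-x\<close>. Hence an ideal contains the component of each of its elements along each coset
  (\<open>ideal_component\<close>), i.e. it is the direct sum of its intersections with the spaces spanned
  by the cosets.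

  They also identify the nonzero homogeneous pieces. For \<open>v\<close> supported on \<open>ker \<mu>\<close>, the operator
  \<open>ad [y - x]\<close> carries \<open>T(x) v\<close> to \<open>\<langle>x, y\<rangle> T(y) v\<close>, so membership of \<open>T(x) v\<close> in the ideal
  implies that of \<open>T(y) v\<close> whenever \<open>\<langle>x, y\<rangle> \<noteq> 0\<close>. Any two \<open>x, y\<close> outside the kernel have a
  common \<open>z\<close> with \<open>\<langle>x, z\<rangle> \<noteq> 0\<close> and \<open>\<langle>y, z\<rangle> \<noteq> 0\<close>, because a group is not the union of two
  proper subgroups, and passing through \<open>z\<close> removes the condition
  (\<open>ideal_translate_transfer\<close>). So one space \<open>V\<close> describes all pieces off the zero coset, while
  the piece \<open>V\<^sub>0\<close> at the zero coset is out of reach of the brackets.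

  The same fact gives the converse: a bracket with \<open>[y]\<close> can only land in the zero coset from the
  coset of \<open>-y\<close>, where its coefficient is \<open>\<langle>-y, y\<rangle> = 0\<close>. Uniqueness holds because each summand
  is recovered as the intersection of the sum with the span of its coset.
\<close>

section \<open>Coefficients and subspaces\<close>

lemma lookup_lin_ext:
  "Poly_Mapping.lookup (lin_ext g u) z =
     (\<Sum>x\<in>Poly_Mapping.keys u. Poly_Mapping.lookup u x * Poly_Mapping.lookup (g x) z)"
  by (simp add: lin_ext_def lookup_sum)

lemma lookup_translate [simp]:
  "Poly_Mapping.lookup (translate x u) z = Poly_Mapping.lookup u (z - x)"
proof -
  have "Poly_Mapping.lookup (translate x u) z =
      (\<Sum>y\<in>Poly_Mapping.keys u. if y = z - x then Poly_Mapping.lookup u y else 0)"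
    unfolding translate_def lookup_lin_ext
    by (intro sum.cong) (auto simp: lookup_single when_def algebra_simps)
  then show ?thesis by (simp add: in_keys_iff)
qed

lemma lin_ext_basis_elt_id: "lin_ext basis_elt u = u"
proof (rule poly_mapping_eqI)
  fix z
  have "Poly_Mapping.lookup (lin_ext basis_elt u) z =
      (\<Sum>x\<in>Poly_Mapping.keys u. if x = z then Poly_Mapping.lookup u x else 0)"
    unfolding lookup_lin_ext by (intro sum.cong) (auto simp: lookup_single when_def)
  then show "Poly_Mapping.lookup (lin_ext basis_elt u) z = Poly_Mapping.lookup u z"
    by (simp add: in_keys_iff)
qed

lemma translate_add: "translate x (u + v) = translate x u + translate x v"
  by (simp add: translate_def lin_ext_add)

lemma translate_qscale: "translate x (qscale c u) = qscale c (translate x u)"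
  by (simp add: translate_def lin_ext_qscale)

lemma subspace_translate_image:
  assumes "QH.subspace V"
  shows "QH.subspace (translate x ` V)"
proof (rule QH.subspaceI)
  show "0 \<in> translate x ` V"
    using QH.subspace_0[OF assms] by (rule rev_image_eqI) (simp add: poly_mapping_eqI)
next
  fix u v assume "u \<in> translate x ` V" "v \<in> translate x ` V"
  then show "u + v \<in> translate x ` V"
    using QH.subspace_add[OF assms] by (auto simp flip: translate_add)
next
  fix c u assume "u \<in> translate x ` V"
  then show "qscale c u \<in> translate x ` V"
    using QH.subspace_scale[OF assms] by (auto simp flip: translate_qscale)
qed

lemma subspace_translate_vimage:
  assumes "QH.subspace V"
  shows "QH.subspace {u. translate x u \<in> V}"
proof (rule QH.subspaceI)
  have "translate x 0 = 0" by (rule poly_mapping_eqI) simp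
  then show "0 \<in> {u. translate x u \<in> V}"
    using QH.subspace_0[OF assms] by simp
qed (auto simp: translate_add translate_qscale
    intro: QH.subspace_add[OF assms] QH.subspace_scale[OF assms])

lemma span_of_eq: "span_of S = {u. Poly_Mapping.keys u \<subseteq> S}"
proof
  have "{u :: 'a \<Rightarrow>\<^sub>0 rat. Poly_Mapping.keys u \<subseteq> S} =
      {u. \<forall>x. x \<notin> S \<longrightarrow> Poly_Mapping.lookup u x = 0}"
    by (auto simp: in_keys_iff)
  moreover have "QH.subspace {u :: 'a \<Rightarrow>\<^sub>0 rat. \<forall>x. x \<notin> S \<longrightarrow> Poly_Mapping.lookup u x = 0}"
    by (rule QH.subspaceI) (simp_all add: lookup_add)
  ultimately have "QH.subspace {u :: 'a \<Rightarrow>\<^sub>0 rat. Poly_Mapping.keys u \<subseteq> S}"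
    by simp
  then show "span_of S \<subseteq> {u. Poly_Mapping.keys u \<subseteq> S}"
    unfolding span_of_def by (intro QH.span_minimal) auto
next
  have "u \<in> span_of S" if "Poly_Mapping.keys u \<subseteq> S" for u
  proof -
    have "lin_ext basis_elt u \<in> span_of S"
      unfolding lin_ext_def span_of_def
      using that by (intro QH.span_sum QH.span_scale QH.span_base) auto
    then show ?thesis by (simp add: lin_ext_basis_elt_id)
  qed
  then show "{u. Poly_Mapping.keys u \<subseteq> S} \<subseteq> span_of S" by blast
qed

lemma subspace_span_of: "QH.subspace (span_of S)"
  by (simp add: span_of_def)

section \<open>Components along a partition of the basis\<close>

definition component :: "'a set \<Rightarrow> ('a \<Rightarrow>\<^sub>0 rat) \<Rightarrow> ('a \<Rightarrow>\<^sub>0 rat)" where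
  "component S = lin_ext (\<lambda>x. if x \<in> S then basis_elt x else 0)"

lemma component_add: "component S (u + v) = component S u + component S v"
  by (simp add: component_def lin_ext_add)

lemma component_qscale: "component S (qscale c u) = qscale c (component S u)"
  by (simp add: component_def lin_ext_qscale)

lemma lookup_component [simp]:
  "Poly_Mapping.lookup (component S u) z = (if z \<in> S then Poly_Mapping.lookup u z else 0)"
proof -
  have "Poly_Mapping.lookup (component S u) z =
      (\<Sum>x\<in>Poly_Mapping.keys u. if x = z then if z \<in> S then Poly_Mapping.lookup u z else 0 else 0)"
    unfolding component_def lookup_lin_ext
    by (intro sum.cong) (auto simp: lookup_single when_def)
  then show ?thesis by (simp add: in_keys_iff)
qed

lemma component_in_span_of: "component S u \<in> span_of S"
  by (auto simp: span_of_eq in_keys_iff split: if_splits)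

lemma component_ident: "u \<in> span_of S \<Longrightarrow> component S u = u"
  by (rule poly_mapping_eqI) (auto simp: span_of_eq in_keys_iff subset_iff)

lemma component_disjoint: "u \<in> span_of S \<Longrightarrow> S \<inter> S' = {} \<Longrightarrow> component S' u = 0"
  by (rule poly_mapping_eqI) (auto simp: span_of_eq in_keys_iff subset_iff)

text \<open>
  The projection onto the span of \<open>C\<close> is the identity on \<open>W C\<close> and kills the other summands, so
  it reads off a summand from any sum of them. The case \<open>C \<notin> J\<close> yields the independence of the
  summands, the case \<open>J = I\<close> their recovery from the sum.
\<close>

lemma component_span_in_summand:
  assumes "disjoint I" "\<And>C. C \<in> I \<Longrightarrow> QH.subspace (W C)" "\<And>C. C \<in> I \<Longrightarrow> W C \<subseteq> span_of C"
    and "C \<in> I" "J \<subseteq> I" "u \<in> QH.span (\<Union>D\<in>J. W D)"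
  shows "component C u \<in> (if C \<in> J then W C else {0})"
proof -
  let ?X = "if C \<in> J then W C else {0}"
  have X: "QH.subspace ?X" using assms(2,4) by simp
  have "QH.subspace {u. component C u \<in> ?X}"
  proof (rule QH.subspaceI)
    have "component C 0 = 0" by (rule poly_mapping_eqI) simp
    then show "0 \<in> {u. component C u \<in> ?X}" using QH.subspace_0[OF X] by simp
  qed (simp_all only: mem_Collect_eq component_add component_qscale
      QH.subspace_add[OF X] QH.subspace_scale[OF X])
  moreover have "component C v \<in> ?X" if "D \<in> J" "v \<in> W D" for D v
  proof (cases "D = C")
    case True
    then show ?thesis using that assms(3,4) component_ident by fastforce
  next
    case False
    then have "D \<inter> C = {}" using assms(1,4,5) that by (auto simp: disjoint_def)
    then have "component C v = 0" using that assms(3,5) component_disjoint by blast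
    then show ?thesis using QH.subspace_0[OF X] by simp
  qed
  ultimately show ?thesis
    using QH.span_minimal[of "\<Union>D\<in>J. W D" "{u. component C u \<in> ?X}"] assms(6) by blast
qed

lemma internal_direct_sum_iff_span:
  assumes "disjoint I" "\<And>C. C \<in> I \<Longrightarrow> QH.subspace (W C)" "\<And>C. C \<in> I \<Longrightarrow> W C \<subseteq> span_of C"
  shows "internal_direct_sum I W U \<longleftrightarrow> U = QH.span (\<Union>C\<in>I. W C)"
proof -
  have "W C \<inter> QH.span (\<Union>D\<in>I - {C}. W D) = {0}" if C: "C \<in> I" for C
  proof -
    have "u = 0" if u: "u \<in> W C" "u \<in> QH.span (\<Union>D\<in>I - {C}. W D)" for u
      using component_span_in_summand[OF assms C _ u(2)] component_ident[of u C] assms(3)[OF C] u(1)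
      by auto
    then show ?thesis using QH.subspace_0[OF assms(2)[OF C]] by (auto simp: QH.span_zero)
  qed
  then show ?thesis using assms(2) by (auto simp: internal_direct_sum_def)
qed

lemma span_summands_Int_span_of:
  assumes "disjoint I" "\<And>C. C \<in> I \<Longrightarrow> QH.subspace (W C)" "\<And>C. C \<in> I \<Longrightarrow> W C \<subseteq> span_of C"
    and "C \<in> I"
  shows "QH.span (\<Union>D\<in>I. W D) \<inter> span_of C = W C"
proof
  show "QH.span (\<Union>D\<in>I. W D) \<inter> span_of C \<subseteq> W C"
    using component_span_in_summand[OF assms order_refl] assms(4) component_ident by fastforce
  show "W C \<subseteq> QH.span (\<Union>D\<in>I. W D) \<inter> span_of C"
    using assms(3,4) QH.span_base by blast
qed

text \<open>
  An element is the sum of its components, finitely many of which are nonzero; the induction splits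
  them off one at a time and measures progress by the size of the support.
\<close>

lemma span_homogeneous_parts:
  assumes "\<Union>I = UNIV" "QH.subspace U" "\<And>C u. C \<in> I \<Longrightarrow> u \<in> U \<Longrightarrow> component C u \<in> U"
  shows "QH.span (\<Union>C\<in>I. U \<inter> span_of C) = U"
proof
  show "QH.span (\<Union>C\<in>I. U \<inter> span_of C) \<subseteq> U"
    using assms(2) by (intro QH.span_minimal) auto
next
  have "u \<in> QH.span (\<Union>C\<in>I. U \<inter> span_of C)" if "u \<in> U" for u
    using that
  proof (induction "card (Poly_Mapping.keys u)" arbitrary: u rule: less_induct)
    case less
    show ?case
    proof (cases "u = 0")
      case True
      then show ?thesis by (simp add: QH.span_zero)
    next
      case False
      then obtain k where k: "k \<in> Poly_Mapping.keys u" by fastforce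
      obtain C where C: "C \<in> I" "k \<in> C" using assms(1) by blast
      define v where "v = u - component C u"
      have v: "Poly_Mapping.lookup v z = (if z \<in> C then 0 else Poly_Mapping.lookup u z)" for z
        by (simp add: v_def lookup_minus)
      have "Poly_Mapping.keys v \<subset> Poly_Mapping.keys u"
        using k C by (auto simp: in_keys_iff v split: if_splits)
      then have "card (Poly_Mapping.keys v) < card (Poly_Mapping.keys u)"
        by (simp add: psubset_card_mono)
      moreover have "v \<in> U"
        unfolding v_def using less.prems assms(2,3) C by (simp add: QH.subspace_diff)
      ultimately have "v \<in> QH.span (\<Union>C\<in>I. U \<inter> span_of C)" using less.hyps by blast
      moreover have "component C u \<in> QH.span (\<Union>C\<in>I. U \<inter> span_of C)"
        using less.prems assms(3) C component_in_span_of by (intro QH.span_base) blast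
      ultimately have "v + component C u \<in> QH.span (\<Union>C\<in>I. U \<inter> span_of C)"
        by (rule QH.span_add)
      then show ?thesis by (simp add: v_def)
    qed
  qed
  then show "U \<subseteq> QH.span (\<Union>C\<in>I. U \<inter> span_of C)" by blast
qed

section \<open>The form and its kernel\<close>

text \<open>
  Twice the difference of the cubes is \<open>a - b\<close> times the sum of squares
  \<open>a\<^sup>2 + b\<^sup>2 + (a + b)\<^sup>2\<close>.
\<close>

lemma cube_injective:
  fixes a b :: "'a::linordered_idom"
  assumes "a ^ 3 = b ^ 3"
  shows "a = b"
proof (rule ccontr)
  assume "a \<noteq> b"
  have "(a - b) * (a\<^sup>2 + b\<^sup>2 + (a + b)\<^sup>2) = 2 * (a ^ 3 - b ^ 3)"
    by (simp add: power2_eq_square power3_eq_cube algebra_simps)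
  then have "a\<^sup>2 + b\<^sup>2 + (a + b)\<^sup>2 = 0" using assms \<open>a \<noteq> b\<close> by simp
  then have "a\<^sup>2 + b\<^sup>2 = 0"
    using zero_le_power2[of a] zero_le_power2[of b] zero_le_power2[of "a + b"] by linarith
  then show False using \<open>a \<noteq> b\<close> by (simp add: sum_power2_eq_zero_iff)
qed

context
  fixes \<omega> :: "'h::ab_group_add \<Rightarrow> 'h \<Rightarrow> int"
  assumes alternating: "alternating_bilinear \<omega>"
begin

lemma form_add_left: "\<omega> (x + y) z = \<omega> x z + \<omega> y z"
  and form_add_right: "\<omega> x (y + z) = \<omega> x y + \<omega> x z"
  and form_self [simp]: "\<omega> x x = 0"
  using alternating by (auto simp: alternating_bilinear_def)

lemma form_zero_left [simp]: "\<omega> 0 y = 0"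
  using form_add_left[of 0 0 y] by simp

lemma form_minus_left: "\<omega> (- x) y = - \<omega> x y"
  using form_add_left[of "- x" x y] by simp

lemma form_minus_right: "\<omega> x (- y) = - \<omega> x y"
  using form_add_right[of x "- y" y] form_add_right[of x 0 0] by simp

lemma form_diff_left: "\<omega> (x - y) z = \<omega> x z - \<omega> y z"
  using form_add_left[of x "- y" z] by (simp add: form_minus_left)

lemma form_diff_right: "\<omega> x (y - z) = \<omega> x y - \<omega> x z"
  using form_add_right[of x y "- z"] by (simp add: form_minus_right)

lemma form_swap: "\<omega> x y = - \<omega> y x"
  using form_self[of "x + y"] by (simp add: form_add_left form_add_right del: form_self) simp

lemmas form_simps = form_add_left form_add_right form_minus_left form_minus_right
  form_diff_left form_diff_right

lemma ker_mu_iff: "x \<in> ker_mu \<omega> \<longleftrightarrow> (\<forall>y. \<omega> x y = 0)"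
  by (auto simp: ker_mu_def mu_def fun_eq_iff)

lemma zero_in_ker_mu [simp]: "0 \<in> ker_mu \<omega>"
  by (simp add: ker_mu_iff)

text \<open>
  Membership in a coset of the kernel becomes equality of all values of the form. In this shape it
  directly supplies the eigenvalues that separate cosets.
\<close>

lemma mem_bar_iff: "z \<in> bar \<omega> x \<longleftrightarrow> (\<forall>y. \<omega> z y = \<omega> x y)"
proof -
  have "z \<in> bar \<omega> x \<longleftrightarrow> z - x \<in> ker_mu \<omega>"
    unfolding bar_def by (auto intro: image_eqI[where x = "z - x"])
  then show ?thesis by (simp add: ker_mu_iff form_simps)
qed

lemma bar_eq_iff: "bar \<omega> x = bar \<omega> y \<longleftrightarrow> x \<in> bar \<omega> y"
  by (auto simp: mem_bar_iff set_eq_iff)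

lemma bar_eq_bar_0_iff: "bar \<omega> x = bar \<omega> 0 \<longleftrightarrow> x \<in> ker_mu \<omega>"
  using bar_eq_iff[of x 0] by (simp add: mem_bar_iff ker_mu_iff)

lemma disjoint_H_bar: "disjoint (H_bar \<omega>)"
  by (auto simp: disjoint_def H_bar_def mem_bar_iff set_eq_iff)

lemma Union_H_bar: "\<Union>(H_bar \<omega>) = UNIV"
  by (auto simp: H_bar_def mem_bar_iff)

text \<open>
  The elements orthogonal to \<open>x\<close> and those orthogonal to \<open>y\<close> are proper subgroups, which cannot
  cover \<open>H\<close>: if \<open>a\<close> lies only in the second and \<open>b\<close> only in the first, then \<open>a + b\<close> is in
  neither.
\<close>

lemma ex_common_nonorthogonal:
  assumes "x \<notin> ker_mu \<omega>" "y \<notin> ker_mu \<omega>"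
  obtains z where "\<omega> x z \<noteq> 0" "\<omega> y z \<noteq> 0"
proof -
  obtain a b where "\<omega> x a \<noteq> 0" "\<omega> y b \<noteq> 0" using assms by (auto simp: ker_mu_iff)
  then have "(\<omega> x a \<noteq> 0 \<and> \<omega> y a \<noteq> 0) \<or> (\<omega> x b \<noteq> 0 \<and> \<omega> y b \<noteq> 0) \<or>
      (\<omega> x (a + b) \<noteq> 0 \<and> \<omega> y (a + b) \<noteq> 0)"
    by (auto simp: form_simps)
  then show ?thesis using that by blast
qed

section \<open>Brackets with basis elements\<close>

text \<open>
  The coefficient of \<open>[z]\<close> comes from \<open>[z - y]\<close> alone, with the factor \<open>\<langle>z - y, y\<rangle>\<close>; this
  equals \<open>\<langle>z, y\<rangle>\<close> as the form is alternating. Iterated brackets can thus be computed one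
  coefficient at a time.
\<close>

lemma lookup_bracket_basis_elt:
  "Poly_Mapping.lookup (goldman_bracket \<omega> u (basis_elt y)) z =
     of_int (\<omega> z y) * Poly_Mapping.lookup u (z - y)"
proof -
  have "Poly_Mapping.lookup (goldman_bracket \<omega> u (basis_elt y)) z =
      (\<Sum>x\<in>Poly_Mapping.keys u.
         if x = z - y then of_int (\<omega> z y) * Poly_Mapping.lookup u (z - y) else 0)"
    unfolding goldman_bracket_def lookup_lin_ext
    by (intro sum.cong) (auto simp: lookup_single when_def form_simps)
  then show ?thesis by (simp add: in_keys_iff)
qed

lemma bracket_in_subspace:
  assumes "QH.subspace U" "\<And>y. goldman_bracket \<omega> u (basis_elt y) \<in> U"
  shows "goldman_bracket \<omega> u v \<in> U"
proof -
  have "goldman_bracket \<omega> u 0 = 0"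
    using goldman_bracket_bilinear(4)[of \<omega> u 0 0] by simp
  then have "QH.subspace {v. goldman_bracket \<omega> u v \<in> U}"
    using assms(1) by (intro QH.subspaceI)
      (auto simp: goldman_bracket_bilinear QH.subspace_0 QH.subspace_add QH.subspace_scale)
  then have "span_of UNIV \<subseteq> {v. goldman_bracket \<omega> u v \<in> U}"
    unfolding span_of_def using assms(2) by (intro QH.span_minimal) auto
  then show ?thesis by (auto simp: span_of_eq)
qed

lemma bracket_span_in_subspace:
  assumes "QH.subspace U" "\<And>u. u \<in> S \<Longrightarrow> goldman_bracket \<omega> u v \<in> U" "u \<in> QH.span S"
  shows "goldman_bracket \<omega> u v \<in> U"
proof -
  have "goldman_bracket \<omega> 0 v = 0"
    using goldman_bracket_bilinear(3)[of \<omega> 0 0 v] by simp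
  then have "QH.subspace {u. goldman_bracket \<omega> u v \<in> U}"
    using assms(1) by (intro QH.subspaceI)
      (auto simp: goldman_bracket_bilinear QH.subspace_0 QH.subspace_add QH.subspace_scale)
  then have "QH.span S \<subseteq> {u. goldman_bracket \<omega> u v \<in> U}"
    using assms(2) by (intro QH.span_minimal) auto
  then show ?thesis using assms(3) by blast
qed

text \<open>
  The support of \<open>T(x) v\<close> lies in a single coset, on which \<open>\<langle>-, y\<rangle>\<close> is constantly
  \<open>\<langle>x, y\<rangle>\<close>.
\<close>

lemma bracket_translate_basis_elt:
  assumes "v \<in> span_of (ker_mu \<omega>)"
  shows "goldman_bracket \<omega> (translate x v) (basis_elt y) =
    qscale (of_int (\<omega> x y)) (translate (x + y) v)"
proof (rule poly_mapping_eqI)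
  fix z
  have "\<omega> z y = \<omega> x y" if "Poly_Mapping.lookup v (z - y - x) \<noteq> 0"
  proof -
    have "z - y - x \<in> ker_mu \<omega>" using assms that by (auto simp: span_of_eq in_keys_iff)
    then have "\<omega> (z - y - x) y = 0" by (simp add: ker_mu_iff)
    then show ?thesis by (simp add: form_simps)
  qed
  then show "Poly_Mapping.lookup (goldman_bracket \<omega> (translate x v) (basis_elt y)) z =
      Poly_Mapping.lookup (qscale (of_int (\<omega> x y)) (translate (x + y) v)) z"
    by (auto simp: lookup_bracket_basis_elt algebra_simps)
qed

lemma translate_in_span_of_bar:
  assumes "v \<in> span_of (ker_mu \<omega>)"
  shows "translate x v \<in> span_of (bar \<omega> x)"
proof -
  have "z \<in> bar \<omega> x" if "Poly_Mapping.lookup v (z - x) \<noteq> 0" for z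
  proof -
    have "z - x \<in> ker_mu \<omega>" using assms that by (auto simp: span_of_eq in_keys_iff)
    then show ?thesis by (simp add: mem_bar_iff ker_mu_iff form_simps)
  qed
  then show ?thesis by (auto simp: span_of_eq in_keys_iff)
qed

lemma translate_back_in_span_of_ker:
  assumes "u \<in> span_of (bar \<omega> x)"
  shows "translate (- x) u \<in> span_of (ker_mu \<omega>)"
proof -
  have "z \<in> ker_mu \<omega>" if "Poly_Mapping.lookup u (z + x) \<noteq> 0" for z
  proof -
    have "z + x \<in> bar \<omega> x" using assms that by (auto simp: span_of_eq in_keys_iff)
    then show ?thesis by (simp add: mem_bar_iff ker_mu_iff form_simps)
  qed
  then show ?thesis by (auto simp: span_of_eq in_keys_iff)
qed

section \<open>Ideals are graded by the cosets of the kernel\<close>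

lemma ideal_bracket: "goldman_ideal \<omega> U \<Longrightarrow> u \<in> U \<Longrightarrow> goldman_bracket \<omega> u v \<in> U"
  and ideal_subspace: "goldman_ideal \<omega> U \<Longrightarrow> QH.subspace U"
  by (auto simp: goldman_ideal_def)

text \<open>
  The third bracket must be with \<open>[-2y]\<close> to undo the shift by \<open>2y\<close>; it contributes the factor
  \<open>-2 \<langle>z, y\<rangle>\<close>, whence the normalization by \<open>-1/2\<close> below.
\<close>

lemma ideal_cube_operator:
  assumes U: "goldman_ideal \<omega> U" and "u \<in> U"
  obtains v where "v \<in> U"
    "\<And>z. Poly_Mapping.lookup v z = of_int (\<omega> z y) ^ 3 * Poly_Mapping.lookup u z"
proof
  define w where "w = goldman_bracket \<omega> (goldman_bracket \<omega> (goldman_bracket \<omega> u (basis_elt y))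
    (basis_elt y)) (basis_elt (- (y + y)))"
  show "qscale (- 1 / 2) w \<in> U"
    unfolding w_def using assms
    by (intro QH.subspace_scale[OF ideal_subspace[OF U]] ideal_bracket[OF U])
  show "Poly_Mapping.lookup (qscale (- 1 / 2) w) z =
      of_int (\<omega> z y) ^ 3 * Poly_Mapping.lookup u z" for z
    by (simp add: w_def lookup_bracket_basis_elt form_simps power3_eq_cube del: minus_add_distrib)
qed

text \<open>
  If the support of \<open>u\<close> contains some \<open>k\<close> outside the coset of \<open>x\<close>, choose \<open>y\<close> with
  \<open>\<langle>k, y\<rangle> \<noteq> \<langle>x, y\<rangle>\<close>. Subtracting \<open>\<langle>k, y\<rangle>\<^sup>3 u\<close> from its image under the cube operator
  removes \<open>k\<close> from the support and multiplies the component along the coset of \<open>x\<close> by a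
  nonzero constant, so induction on the size of the support applies.
\<close>

lemma ideal_component:
  assumes U: "goldman_ideal \<omega> U" and "u \<in> U"
  shows "component (bar \<omega> x) u \<in> U"
  using assms(2)
proof (induction "card (Poly_Mapping.keys u)" arbitrary: u rule: less_induct)
  case less
  note sub = ideal_subspace[OF U]
  show ?case
  proof (cases "Poly_Mapping.keys u \<subseteq> bar \<omega> x")
    case True
    then show ?thesis using less.prems component_ident[of u "bar \<omega> x"] by (simp add: span_of_eq)
  next
    case False
    then obtain k where k: "k \<in> Poly_Mapping.keys u" "k \<notin> bar \<omega> x" by blast
    then obtain y where y: "\<omega> k y \<noteq> \<omega> x y" by (auto simp: mem_bar_iff)
    obtain v where v: "v \<in> U"
      "\<And>z. Poly_Mapping.lookup v z = of_int (\<omega> z y) ^ 3 * Poly_Mapping.lookup u z"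
      using ideal_cube_operator[OF U less.prems] by blast
    define w where "w = v - qscale (of_int (\<omega> k y) ^ 3) u"
    have w: "Poly_Mapping.lookup w z =
        (of_int (\<omega> z y) ^ 3 - of_int (\<omega> k y) ^ 3) * Poly_Mapping.lookup u z" for z
      by (simp add: w_def lookup_minus v algebra_simps)
    have "Poly_Mapping.keys w \<subset> Poly_Mapping.keys u"
      using k by (auto simp: in_keys_iff w)
    then have "card (Poly_Mapping.keys w) < card (Poly_Mapping.keys u)"
      by (simp add: psubset_card_mono)
    moreover have "w \<in> U"
      unfolding w_def using less.prems v(1) sub
      by (simp add: QH.subspace_diff QH.subspace_scale)
    ultimately have "component (bar \<omega> x) w \<in> U" using less.hyps by blast
    moreover define c :: rat where "c = of_int (\<omega> x y) ^ 3 - of_int (\<omega> k y) ^ 3"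
    have "component (bar \<omega> x) w = qscale c (component (bar \<omega> x) u)"
      by (rule poly_mapping_eqI) (auto simp: w c_def mem_bar_iff)
    moreover have "c \<noteq> 0"
    proof -
      have "\<omega> x y ^ 3 \<noteq> \<omega> k y ^ 3"
        using y cube_injective[of "\<omega> x y" "\<omega> k y"] by auto
      then show ?thesis unfolding c_def by (metis eq_iff_diff_eq_0 of_int_eq_iff of_int_power)
    qed
    ultimately have "qscale (1 / c) (qscale c (component (bar \<omega> x) u)) \<in> U"
      using QH.subspace_scale[OF sub] by metis
    then show ?thesis using \<open>c \<noteq> 0\<close> by simp
  qed
qed

section \<open>All nonzero graded pieces are translates of one another\<close>

lemma ideal_translate_step:
  assumes U: "goldman_ideal \<omega> U" and v: "v \<in> span_of (ker_mu \<omega>)"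
    and "\<omega> x y \<noteq> 0" "translate x v \<in> U"
  shows "translate y v \<in> U"
proof -
  have "goldman_bracket \<omega> (translate x v) (basis_elt (y - x)) \<in> U"
    using ideal_bracket[OF U] assms(4) .
  then have "qscale (of_int (\<omega> x y)) (translate y v) \<in> U"
    by (simp add: bracket_translate_basis_elt[OF v] form_simps)
  then have "qscale (1 / of_int (\<omega> x y)) (qscale (of_int (\<omega> x y)) (translate y v)) \<in> U"
    using QH.subspace_scale[OF ideal_subspace[OF U]] by blast
  then show ?thesis using assms(3) by simp
qed

lemma ideal_translate_transfer:
  assumes U: "goldman_ideal \<omega> U" and v: "v \<in> span_of (ker_mu \<omega>)"
    and "x \<notin> ker_mu \<omega>" "y \<notin> ker_mu \<omega>" "translate x v \<in> U"
  shows "translate y v \<in> U"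
proof -
  obtain z where z: "\<omega> x z \<noteq> 0" "\<omega> y z \<noteq> 0"
    using ex_common_nonorthogonal assms(3,4) .
  then have "\<omega> z y \<noteq> 0" using form_swap[of y z] by simp
  then show ?thesis using ideal_translate_step[OF U v] z(1) assms(5) by blast
qed

section \<open>The summands attached to a pair of subspaces\<close>

lemma goldman_summand_bar:
  assumes "ker_stable \<omega> V"
  shows "goldman_summand \<omega> V0 V (bar \<omega> x) =
    (if x \<in> ker_mu \<omega> then V0 else translate x ` V)"
  using translate_coset_bar[OF alternating assms]
  by (simp add: goldman_summand_def bar_eq_bar_0_iff)

lemma goldman_summand_graded:
  assumes "kernel_subspace \<omega> V0" "kernel_subspace \<omega> V" "ker_stable \<omega> V" "C \<in> H_bar \<omega>"
  shows "QH.subspace (goldman_summand \<omega> V0 V C)" "goldman_summand \<omega> V0 V C \<subseteq> span_of C"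
proof -
  obtain x where C: "C = bar \<omega> x" using assms(4) by (auto simp: H_bar_def)
  show "QH.subspace (goldman_summand \<omega> V0 V C)"
    using assms
    by (simp add: C goldman_summand_bar kernel_subspace_def subspace_translate_image)
  have "bar \<omega> x = ker_mu \<omega>" if "x \<in> ker_mu \<omega>"
    using that bar_eq_bar_0_iff bar_0 by metis
  then show "goldman_summand \<omega> V0 V C \<subseteq> span_of C"
    using assms translate_in_span_of_bar
    by (auto simp: C goldman_summand_bar kernel_subspace_def)
qed

lemma goldman_direct_sum_iff_span:
  assumes "kernel_subspace \<omega> V0" "kernel_subspace \<omega> V" "ker_stable \<omega> V"
  shows "internal_direct_sum (H_bar \<omega>) (goldman_summand \<omega> V0 V) U \<longleftrightarrow>
    U = QH.span (\<Union>C\<in>H_bar \<omega>. goldman_summand \<omega> V0 V C)"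
  using goldman_summand_graded[OF assms] by (intro internal_direct_sum_iff_span disjoint_H_bar)

text \<open>
  The sum determines its summands, since each of them is the part supported on one coset.
\<close>

lemma goldman_direct_sum_summand:
  assumes "kernel_subspace \<omega> V0" "kernel_subspace \<omega> V" "ker_stable \<omega> V"
    and "internal_direct_sum (H_bar \<omega>) (goldman_summand \<omega> V0 V) U"
  shows "U \<inter> span_of (bar \<omega> x) = (if x \<in> ker_mu \<omega> then V0 else translate x ` V)"
proof -
  have "bar \<omega> x \<in> H_bar \<omega>" by (simp add: H_bar_def)
  then have "QH.span (\<Union>C\<in>H_bar \<omega>. goldman_summand \<omega> V0 V C) \<inter> span_of (bar \<omega> x) =
      goldman_summand \<omega> V0 V (bar \<omega> x)"
    using span_summands_Int_span_of[OF disjoint_H_bar goldman_summand_graded[OF assms(1-3)]]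
    by blast
  then show ?thesis
    using assms(4) goldman_direct_sum_iff_span[OF assms(1-3)] goldman_summand_bar[OF assms(3)]
    by metis
qed

text \<open>
  A bracket of \<open>T(x) v\<close> with \<open>[y]\<close> is a multiple of \<open>T(x + y) v\<close> by \<open>\<langle>x, y\<rangle> = \<langle>x + y, y\<rangle>\<close>.
  If this factor is nonzero, then neither \<open>x\<close> nor \<open>x + y\<close> lies in the kernel, so \<open>v \<in> V\<close>
  and \<open>T(x + y) v\<close> belongs to a summand again. In particular every bracket out of \<open>V\<^sub>0\<close>,
  or into the zero coset, vanishes.
\<close>

lemma goldman_direct_sum_ideal:
  assumes "kernel_subspace \<omega> V0" "kernel_subspace \<omega> V" "ker_stable \<omega> V"
  shows "goldman_ideal \<omega> (QH.span (\<Union>C\<in>H_bar \<omega>. goldman_summand \<omega> V0 V C))"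
    (is "goldman_ideal \<omega> ?U")
proof -
  have "goldman_bracket \<omega> u (basis_elt y) \<in> ?U"
    if "u \<in> goldman_summand \<omega> V0 V (bar \<omega> x)" for u x y
  proof -
    \<comment> \<open>A uniform shape for both kinds of summand: elements of \<open>V\<^sub>0\<close> are translates by 0.\<close>
    obtain x' v where v: "u = translate x' v" "v \<in> span_of (ker_mu \<omega>)"
      and x': "x' \<notin> ker_mu \<omega> \<Longrightarrow> v \<in> V"
    proof (cases "x \<in> ker_mu \<omega>")
      case True
      then show ?thesis
        using that[of 0 u] \<open>u \<in> _\<close> assms
        by (auto simp: goldman_summand_bar kernel_subspace_def)
    next
      case False
      then show ?thesis
        using that[of x] \<open>u \<in> _\<close> assms
        by (auto simp: goldman_summand_bar kernel_subspace_def)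
    qed
    show ?thesis
    proof (cases "\<omega> x' y = 0")
      case True
      then show ?thesis by (simp add: v bracket_translate_basis_elt QH.span_zero)
    next
      case False
      then have "\<omega> (x' + y) y \<noteq> 0" by (simp add: form_simps)
      then have "x' + y \<notin> ker_mu \<omega>" "x' \<notin> ker_mu \<omega>" using False by (auto simp: ker_mu_iff)
      then have "translate (x' + y) v \<in> goldman_summand \<omega> V0 V (bar \<omega> (x' + y))"
        using x' assms by (simp add: goldman_summand_bar)
      then have "translate (x' + y) v \<in> ?U"
        by (intro QH.span_base) (auto simp: H_bar_def)
      then show ?thesis by (simp add: v bracket_translate_basis_elt QH.span_scale)
    qed
  qed
  then have summand: "goldman_bracket \<omega> u v \<in> ?U"
    if "u \<in> (\<Union>C\<in>H_bar \<omega>. goldman_summand \<omega> V0 V C)" for u v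
    using that by - (rule bracket_in_subspace[OF QH.subspace_span], auto simp: H_bar_def)
  have "goldman_bracket \<omega> u v \<in> ?U" if "u \<in> ?U" for u v
    by (rule bracket_span_in_subspace[OF QH.subspace_span _ that]) (rule summand)
  then show ?thesis unfolding goldman_ideal_def by (intro conjI QH.subspace_span ballI allI)
qed

lemma goldman_direct_sum_unique:
  assumes "kernel_subspace \<omega> V0" "kernel_subspace \<omega> V" "ker_stable \<omega> V"
    and "internal_direct_sum (H_bar \<omega>) (goldman_summand \<omega> V0 V) U"
    and "mu \<omega> = (\<lambda>x y. 0) \<Longrightarrow> V = {0}"
    and "kernel_subspace \<omega> V0'" "kernel_subspace \<omega> V'" "ker_stable \<omega> V'"
    and "internal_direct_sum (H_bar \<omega>) (goldman_summand \<omega> V0' V') U"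
    and "mu \<omega> = (\<lambda>x y. 0) \<Longrightarrow> V' = {0}"
  shows "V0 = V0'" "V = V'"
proof -
  note pieces = goldman_direct_sum_summand[OF assms(1-4)] goldman_direct_sum_summand[OF assms(6-9)]
  show "V0 = V0'" using pieces[of 0] by simp
  show "V = V'"
  proof (cases "mu \<omega> = (\<lambda>x y. 0)")
    case True
    then show ?thesis using assms(5,10) by simp
  next
    case False
    then obtain x where "x \<notin> ker_mu \<omega>" by (auto simp: ker_mu_def)
    then have "translate x ` V = translate x ` V'" using pieces[of x] by simp
    then have "translate (- x) ` translate x ` V = translate (- x) ` translate x ` V'" by simp
    then show ?thesis by (simp add: image_image translate_translate)
  qed
qed

text \<open>
  Take for \<open>V\<close> the vectors all of whose translates off the kernel lie in the ideal. This avoids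
  choosing a representative and makes stability immediate, since \<open>x + a\<close> runs through the same
  elements as \<open>x\<close>; that a single translate suffices is the transfer lemma.
\<close>

lemma goldman_ideal_decomposition:
  assumes U: "goldman_ideal \<omega> U"
  obtains V0 V where "kernel_subspace \<omega> V0" "kernel_subspace \<omega> V" "ker_stable \<omega> V"
    "internal_direct_sum (H_bar \<omega>) (goldman_summand \<omega> V0 V) U"
    "mu \<omega> = (\<lambda>x y. 0) \<Longrightarrow> V = {0}"
proof -
  define V0 where "V0 = U \<inter> span_of (ker_mu \<omega>)"
  \<comment> \<open>If \<open>\<mu> = 0\<close>, the intersection has no members and would impose no condition.\<close>
  define V where "V = (if mu \<omega> = (\<lambda>x y. 0) then {0}
    else span_of (ker_mu \<omega>) \<inter> (\<Inter>x\<in>- ker_mu \<omega>. {v. translate x v \<in> U}))"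
  note sub = ideal_subspace[OF U]
  have V0: "kernel_subspace \<omega> V0"
    unfolding V0_def kernel_subspace_def using sub by (simp add: QH.subspace_inter subspace_span_of)
  have V: "kernel_subspace \<omega> V"
    unfolding V_def kernel_subspace_def
    using subspace_span_of[of "ker_mu \<omega>"] subspace_translate_vimage[OF sub]
    by (auto simp: QH.subspace_0 intro!: QH.subspace_inter QH.subspace_Inter)
  have stable: "ker_stable \<omega> V"
  proof -
    have "translate a v \<in> V" if a: "a \<in> ker_mu \<omega>" and v: "v \<in> V" for a v
    proof (cases "mu \<omega> = (\<lambda>x y. 0)")
      case True
      moreover have "translate a 0 = 0" by (rule poly_mapping_eqI) simp
      ultimately show ?thesis using v by (simp add: V_def)
    next
      case False
      have "bar \<omega> a = ker_mu \<omega>" using a bar_eq_bar_0_iff bar_0 by metis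
      then have "translate a v \<in> span_of (ker_mu \<omega>)"
        using translate_in_span_of_bar[of v a] v False by (simp add: V_def)
      moreover have "translate x (translate a v) \<in> U" if "x \<notin> ker_mu \<omega>" for x
      proof -
        have "x + a \<notin> ker_mu \<omega>" using that a by (simp add: ker_mu_iff form_simps)
        then show ?thesis using v False by (simp add: V_def translate_translate)
      qed
      ultimately show ?thesis using False by (simp add: V_def)
    qed
    then show ?thesis by (auto simp: ker_stable_def)
  qed
  have piece: "goldman_summand \<omega> V0 V (bar \<omega> x) = U \<inter> span_of (bar \<omega> x)" for x
  proof (cases "x \<in> ker_mu \<omega>")
    case True
    then have "U \<inter> span_of (bar \<omega> x) = V0"
      unfolding V0_def using bar_eq_bar_0_iff bar_0 by metis
    then show ?thesis using True by (simp add: goldman_summand_bar[OF stable])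
  next
    case False
    then have V_eq: "V = span_of (ker_mu \<omega>) \<inter> (\<Inter>x\<in>- ker_mu \<omega>. {v. translate x v \<in> U})"
      by (auto simp: V_def ker_mu_def)
    have "translate x ` V = U \<inter> span_of (bar \<omega> x)"
    proof
      show "translate x ` V \<subseteq> U \<inter> span_of (bar \<omega> x)"
        using False translate_in_span_of_bar by (auto simp: V_eq)
      show "U \<inter> span_of (bar \<omega> x) \<subseteq> translate x ` V"
      proof
        fix u assume u: "u \<in> U \<inter> span_of (bar \<omega> x)"
        define v where "v = translate (- x) u"
        have v: "v \<in> span_of (ker_mu \<omega>)" "u = translate x v"
          using u translate_back_in_span_of_ker by (auto simp: v_def translate_translate)
        then have "v \<in> V"
          using u False ideal_translate_transfer[OF U v(1) False] by (auto simp: V_eq)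
        then show "u \<in> translate x ` V" using v(2) by blast
      qed
    qed
    then show ?thesis using False by (simp add: goldman_summand_bar[OF stable])
  qed
  have "(\<Union>C\<in>H_bar \<omega>. goldman_summand \<omega> V0 V C) = (\<Union>C\<in>H_bar \<omega>. U \<inter> span_of C)"
    using piece by (simp add: H_bar_def)
  moreover have "QH.span (\<Union>C\<in>H_bar \<omega>. U \<inter> span_of C) = U"
    using Union_H_bar sub ideal_component[OF U]
    by (intro span_homogeneous_parts) (auto simp: H_bar_def)
  ultimately have "internal_direct_sum (H_bar \<omega>) (goldman_summand \<omega> V0 V) U"
    by (simp add: goldman_direct_sum_iff_span[OF V0 V stable])
  then show ?thesis using that[OF V0 V stable] by (simp add: V_def)
qed

end

section \<open>Classification of the ideals\<close>

theorem theorem1p1: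
  fixes \<omega> :: "'h::ab_group_add \<Rightarrow> 'h \<Rightarrow> int"
  assumes "alternating_bilinear \<omega>"
  shows
    "(\<forall>\<h>. goldman_ideal \<omega> \<h> \<longrightarrow>
        (\<exists>!(V0, V).
           kernel_subspace \<omega> V0 \<and> kernel_subspace \<omega> V \<and>
           ker_stable \<omega> V \<and>
           internal_direct_sum (H_bar \<omega>) (goldman_summand \<omega> V0 V) \<h> \<and>
           (mu \<omega> = (\<lambda>x y. 0) \<longrightarrow> V = {0}))) \<and>
     (\<forall>V0 V.
        kernel_subspace \<omega> V0 \<and> kernel_subspace \<omega> V \<and> ker_stable \<omega> V \<longrightarrow>
        (\<exists>\<h>. internal_direct_sum (H_bar \<omega>) (goldman_summand \<omega> V0 V) \<h>) \<and>
        (\<forall>\<h>. internal_direct_sum (H_bar \<omega>) (goldman_summand \<omega> V0 V) \<h> \<longrightarrow>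
              goldman_ideal \<omega> \<h>))"
proof (intro conjI allI impI)
  fix \<h> assume "goldman_ideal \<omega> \<h>"
  then obtain V0 V where V: "kernel_subspace \<omega> V0" "kernel_subspace \<omega> V" "ker_stable \<omega> V"
      "internal_direct_sum (H_bar \<omega>) (goldman_summand \<omega> V0 V) \<h>"
      "mu \<omega> = (\<lambda>x y. 0) \<Longrightarrow> V = {0}"
    using goldman_ideal_decomposition[OF assms] by blast
  show "\<exists>!(V0, V).
      kernel_subspace \<omega> V0 \<and> kernel_subspace \<omega> V \<and> ker_stable \<omega> V \<and>
      internal_direct_sum (H_bar \<omega>) (goldman_summand \<omega> V0 V) \<h> \<and>
      (mu \<omega> = (\<lambda>x y. 0) \<longrightarrow> V = {0})"
  proof (rule ex1I[of _ "(V0, V)"], goal_cases)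
    case 1
    then show ?case using V by simp
  next
    case (2 p)
    then show ?case
      using goldman_direct_sum_unique[OF assms V, of "fst p" "snd p"]
      by (auto simp: case_prod_beta prod_eq_iff)
  qed
next
  fix V0 V
  assume V: "kernel_subspace \<omega> V0 \<and> kernel_subspace \<omega> V \<and> ker_stable \<omega> V"
  then have iff: "internal_direct_sum (H_bar \<omega>) (goldman_summand \<omega> V0 V) U \<longleftrightarrow>
      U = QH.span (\<Union>C\<in>H_bar \<omega>. goldman_summand \<omega> V0 V C)" for U
    using goldman_direct_sum_iff_span[OF assms] by blast
  show "\<exists>\<h>. internal_direct_sum (H_bar \<omega>) (goldman_summand \<omega> V0 V) \<h>"
    by (simp add: iff)
  show "goldman_ideal \<omega> \<h>" if "internal_direct_sum (H_bar \<omega>) (goldman_summand \<omega> V0 V) \<h>" for \<h>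
    using that V goldman_direct_sum_ideal[OF assms] by (simp add: iff)
qed

end
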